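(* Let $n\ge 1$ be an integer, let $\omega\in\mathbb{C}$, and let $\mathbf{M}_n\in\mathbb{C}^{n\times(n+1)}$ be the matrix with entries $1$ on the main diagonal (positions $(j,j)$, $1\le j\le n$), entries $\omega$ on the superdiagonal (positions $(j,j+1)$, $1\le j\le n$), and zeros elsewhere. Then $$1\le \kappa(\mathbf{M}_n)\le \begin{cases}\left|\dfrac{|\omega|+1}{|\omega|-1}\right| & \text{for } |\omega|\in(0,1)\cup(1,\infty),\\[2mm] \dfrac{2}{\pi}(n+1) & \text{for } |\omega|=1.\end{cases}$$ Moreover, for $|\omega|\in(0,1)\cup(1,\infty)$, $\sigma_{\max}(\mathbf{M}_n)\le \big||\omega|+1\big|$ and $\sigma_{\min}(\mathbf{M}_n)\ge \big||\omega|-1\big|$.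
   Context: The singular values of $\mathbf{M}_n$ are $\sigma_j(\mathbf{M}_n)=\sqrt{\lambda_j(\mathbf{M}_n\mathbf{M}_n^* )}$, $j\in\{1,\dots,n\}$, where $\lambda_j$ denotes the eigenvalues of the $n\times n$ Hermitian matrix $\mathbf{M}_n\mathbf{M}_n^*$ and $*$ is the Hermitian transpose; $\sigma_{\max}$ and $\sigma_{\min}$ are the largest and smallest of these $n$ values. The condition number is $\kappa(\mathbf{M}_n)=\sigma_{\max}(\mathbf{M}_n)/\sigma_{\min}(\mathbf{M}_n)$. *)

theory Defs
  imports "Jordan_Normal_Form.Schur_Decomposition" "Jordan_Normal_Form.Spectral_Radius"
begin

(* The eigenvalues of the Hermitian positive semidefinite matrix A A^* are real and nonnegative,
   so taking the real part loses nothing. The result is a set: multiplicities are forgotten,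
   which does not affect the largest and the smallest singular value. If A has n rows, A A^* is
   n x n, so there are n singular values counted with multiplicity, also when A is not square. *)
definition singular_values :: "complex mat \<Rightarrow> real set" where
  "singular_values A = (\<lambda>l. sqrt (Re l)) ` spectrum (A * mat_adjoint A)"

definition sigma_max :: "complex mat \<Rightarrow> real" where
  "sigma_max A = Max (singular_values A)"

definition sigma_min :: "complex mat \<Rightarrow> real" where
  "sigma_min A = Min (singular_values A)"

definition condition_number :: "complex mat \<Rightarrow> real" where
  "condition_number A = sigma_max A / sigma_min A"

(* Indices start at 0, so position (j, j + 1) is still the superdiagonal. *)
definition bidiagonal_mat :: "nat \<Rightarrow> complex \<Rightarrow> complex mat" where
  "bidiagonal_mat n \<omega> =
     mat n (n + 1) (\<lambda>(i, j). if j = i then 1 else if j = i + 1 then \<omega> else 0)"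

end

theory Submission
  imports Defs
begin

text \<open>
  The matrix \<open>A = M M\<^sup>*\<close> is tridiagonal, with \<open>1 + |\<omega>|\<^sup>2\<close> on the diagonal and entries of modulus
  \<open>|\<omega>|\<close> next to it. The vector with entries \<open>s\<^sub>j = sin (j \<pi> / (n + 1))\<close> is positive and is the Perron
  eigenvector of the path with \<open>n\<close> vertices, for the eigenvalue \<open>2 c\<close>, \<open>c = cos (\<pi> / (n + 1))\<close>.
  If \<open>A v = l v\<close>, then taking moduli row by row and pairing with \<open>s\<close> gives
  \<open>|l - (1 + |\<omega>|\<^sup>2)| \<le> 2 |\<omega>| c\<close>. All claims follow from this; for \<open>|\<omega>| = 1\<close> the squared
  singular values lie between \<open>4 sin\<^sup>2 x\<close> and \<open>4 cos\<^sup>2 x\<close> with \<open>x = \<pi> / (2 (n + 1))\<close>, and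
  \<open>x \<le> tan x\<close>.
\<close>

lemma bidiagonal_mat_gram_index:
  assumes "i < n" "j < n"
  shows "(bidiagonal_mat n \<omega> * mat_adjoint (bidiagonal_mat n \<omega>)) $$ (i, j) =
    (if j = i then complex_of_real (1 + (cmod \<omega>)\<^sup>2) else 0) +
    (if j = Suc i then \<omega> else 0) + (if i = Suc j then cnj \<omega> else 0)"
proof -
  let ?b = "\<lambda>i k. if k = i then 1 else if k = i + 1 then \<omega> else (0::complex)"
  have "(bidiagonal_mat n \<omega> * mat_adjoint (bidiagonal_mat n \<omega>)) $$ (i, j) =
      (\<Sum>k<n + 1. ?b i k * cnj (?b j k))"
    using assms
    by (auto simp: bidiagonal_mat_def mat_adjoint_def scalar_prod_def mat_of_rows_def
        lessThan_atLeast0 intro!: sum.cong)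
  also have "\<dots> = (\<Sum>k<n + 1. (if k = i then cnj (?b j k) else 0) +
      (if k = Suc i then \<omega> * cnj (?b j k) else 0))"
    by (intro sum.cong) auto
  also have "\<dots> = cnj (?b j i) + \<omega> * cnj (?b j (Suc i))"
    using assms by (simp add: sum.distrib)
  finally show ?thesis
    by (auto simp: complex_norm_square simp flip: of_real_power)
qed

text \<open>\<open>u\<close> is \<open>v\<close> moved to the indices 1 to n and padded with 0 at 0
  and n + 1. The padding gives the first and last rows the form of the interior ones and supplies
  the zero boundary values for \<open>sum_path_sin\<close>.\<close>

lemma bidiagonal_mat_gram_mult_vec_index:
  assumes "v \<in> carrier_vec n" "i < n"
    and u: "\<And>j. u j = (if 1 \<le> j \<and> j \<le> n then v $ (j - 1) else 0)"
  shows "(bidiagonal_mat n \<omega> * mat_adjoint (bidiagonal_mat n \<omega>) *\<^sub>v v) $ i =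
    complex_of_real (1 + (cmod \<omega>)\<^sup>2) * u (Suc i) + \<omega> * u (Suc (Suc i)) + cnj \<omega> * u i"
proof -
  let ?a = "complex_of_real (1 + (cmod \<omega>)\<^sup>2)"
  let ?A = "bidiagonal_mat n \<omega> * mat_adjoint (bidiagonal_mat n \<omega>)"
  have dims: "dim_row ?A = n" "dim_col ?A = n"
    by (auto simp: bidiagonal_mat_def mat_adjoint_def)
  have "(?A *\<^sub>v v) $ i = (\<Sum>j<n. ?A $$ (i, j) * v $ j)"
    using assms dims by (simp add: scalar_prod_def lessThan_atLeast0 row_def del: index_mult_mat)
  also have "\<dots> = (\<Sum>j<n. (if j = i then ?a * v $ j else 0) +
      (if j = Suc i then \<omega> * v $ j else 0) + (if i = Suc j then cnj \<omega> * v $ j else 0))"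
    using assms by (intro sum.cong) (auto simp: bidiagonal_mat_gram_index simp del: index_mult_mat)
  also have "\<dots> = ?a * v $ i + (if Suc i < n then \<omega> * v $ Suc i else 0) +
      (\<Sum>j<n. if i = Suc j then cnj \<omega> * v $ j else 0)"
    using assms by (simp add: sum.distrib)
  \<comment> \<open>Row 0 has no left neighbour: the sum vanishes there, as does
    \<open>u 0\<close>.\<close>
  also have "(\<Sum>j<n. if i = Suc j then cnj \<omega> * v $ j else 0) = cnj \<omega> * u i"
    using assms by (cases i) auto
  finally show ?thesis
    using assms by auto
qed

text \<open>The summand is the increment of the discrete Wronskian
  \<open>s i * w (Suc i) - w i * s (Suc i)\<close>, so the sum telescopes.\<close>

lemma sum_green_identity:
  fixes s w :: "nat \<Rightarrow> 'a::comm_ring_1"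
  shows "(\<Sum>i<n. s (Suc i) * (w (Suc (Suc i)) + w i) - w (Suc i) * (s (Suc (Suc i)) + s i)) =
    s n * w (Suc n) - w n * s (Suc n) - (s 0 * w 1 - w 0 * s 1)"
  by (induction n) (auto simp: algebra_simps)

text \<open>The adjacency operator of the path is symmetric on sequences vanishing at 0 and n + 1.
  It can therefore be moved from \<open>w\<close> to the sine, where it acts as the scalar
  \<open>2 * cos x\<close>.\<close>

lemma sum_path_sin:
  fixes w :: "nat \<Rightarrow> real"
  assumes "w 0 = 0" "w (Suc n) = 0"
  defines "x \<equiv> pi / (real n + 1)"
  shows "(\<Sum>i<n. sin (real (Suc i) * x) * (w (Suc (Suc i)) + w i)) =
    2 * cos x * (\<Sum>i<n. sin (real (Suc i) * x) * w (Suc i))"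
proof -
  define s where "s i = sin (real i * x)" for i
  \<comment> \<open>The angle at index n + 1 is exactly pi.\<close>
  have end_zero: "s (Suc n) = 0"
    by (simp add: s_def x_def add.commute)
  have rec: "s (Suc (Suc i)) + s i = 2 * cos x * s (Suc i)" for i
  proof -
    have "s (Suc (Suc i)) = sin (real (Suc i) * x + x)" "s i = sin (real (Suc i) * x - x)"
      by (simp_all add: s_def algebra_simps)
    then show ?thesis
      by (simp add: s_def sin_add sin_diff)
  qed
  have "(\<Sum>i<n. s (Suc i) * (w (Suc (Suc i)) + w i) - w (Suc i) * (s (Suc (Suc i)) + s i)) = 0"
    using assms(1,2) end_zero by (subst sum_green_identity) (simp add: s_def)
  then have "(\<Sum>i<n. s (Suc i) * (w (Suc (Suc i)) + w i)) =
      (\<Sum>i<n. w (Suc i) * (s (Suc (Suc i)) + s i))"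
    by (simp add: sum_subtractf)
  also have "\<dots> = 2 * cos x * (\<Sum>i<n. s (Suc i) * w (Suc i))"
    by (simp add: rec sum_distrib_left mult_ac)
  finally show ?thesis
    by (simp only: s_def)
qed

text \<open>Bounding row sums of moduli would only give the radius \<open>2 * cmod \<omega>\<close>,
  hence the useless lower bound 0 when \<open>cmod \<omega> = 1\<close>. The cosine factor comes
  from weighting the rows by the sines.\<close>

lemma bidiagonal_mat_gram_spectrum_bound:
  assumes "l \<in> spectrum (bidiagonal_mat n \<omega> * mat_adjoint (bidiagonal_mat n \<omega>))"
  shows "cmod (l - complex_of_real (1 + (cmod \<omega>)\<^sup>2)) \<le> 2 * cmod \<omega> * cos (pi / (real n + 1))"
proof -
  let ?A = "bidiagonal_mat n \<omega> * mat_adjoint (bidiagonal_mat n \<omega>)"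
  let ?a = "complex_of_real (1 + (cmod \<omega>)\<^sup>2)"
  define x where "x = pi / (real n + 1)"
  have "dim_row ?A = n"
    by (simp add: bidiagonal_mat_def)
  then obtain v where v: "v \<in> carrier_vec n" "v \<noteq> 0\<^sub>v n" and Av: "?A *\<^sub>v v = l \<cdot>\<^sub>v v"
    using assms unfolding spectrum_def eigenvalue_def eigenvector_def by auto
  define u where "u j = (if 1 \<le> j \<and> j \<le> n then v $ (j - 1) else 0)" for j
  have row: "cmod (l - ?a) * cmod (u (Suc i)) \<le> cmod \<omega> * (cmod (u (Suc (Suc i))) + cmod (u i))"
    if "i < n" for i
  proof -
    have "l * u (Suc i) = ?a * u (Suc i) + \<omega> * u (Suc (Suc i)) + cnj \<omega> * u i"
      using bidiagonal_mat_gram_mult_vec_index[OF v(1) that u_def, of \<omega>] v(1) that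
      by (simp add: Av u_def)
    then have "(l - ?a) * u (Suc i) = \<omega> * u (Suc (Suc i)) + cnj \<omega> * u i"
      by (simp add: algebra_simps)
    then have "cmod (l - ?a) * cmod (u (Suc i)) = cmod (\<omega> * u (Suc (Suc i)) + cnj \<omega> * u i)"
      by (metis norm_mult)
    also have "\<dots> \<le> cmod \<omega> * (cmod (u (Suc (Suc i))) + cmod (u i))"
      by (rule order_trans[OF norm_triangle_ineq]) (simp add: norm_mult algebra_simps)
    finally show ?thesis .
  qed
  \<comment> \<open>The angles lie strictly between 0 and pi. Positive weights preserve the row
    inequalities when they are summed.\<close>
  have sin_pos: "0 < sin (real (Suc i) * x)" if "i < n" for i
  proof (rule sin_gt_zero)
    show "real (Suc i) * x < pi"
      using that by (simp add: x_def field_simps)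
  qed (simp add: x_def)
  let ?S = "\<Sum>i<n. sin (real (Suc i) * x) * cmod (u (Suc i))"
  have "cmod (l - ?a) * ?S =
      (\<Sum>i<n. sin (real (Suc i) * x) * (cmod (l - ?a) * cmod (u (Suc i))))"
    by (simp only: sum_distrib_left mult_ac)
  also have "\<dots> \<le> (\<Sum>i<n. sin (real (Suc i) * x) *
      (cmod \<omega> * (cmod (u (Suc (Suc i))) + cmod (u i))))"
    by (intro sum_mono mult_left_mono row) (use sin_pos in \<open>auto simp: less_imp_le\<close>)
  also have "\<dots> = cmod \<omega> *
      (\<Sum>i<n. sin (real (Suc i) * x) * (cmod (u (Suc (Suc i))) + cmod (u i)))"
    by (simp only: sum_distrib_left mult_ac)
  also have "\<dots> = 2 * cmod \<omega> * cos x * ?S"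
    using sum_path_sin[of "\<lambda>j. cmod (u j)" n] by (simp add: u_def x_def)
  finally have le: "cmod (l - ?a) * ?S \<le> 2 * cmod \<omega> * cos x * ?S" .
  \<comment> \<open>A nonzero entry of the eigenvector makes the weighted sum positive, so it can be
    cancelled.\<close>
  obtain i where i: "i < n" "v $ i \<noteq> 0"
    using v by (metis carrier_vecD eq_vecI index_zero_vec)
  have "0 < ?S"
    by (rule sum_pos2[of _ i]) (use i sin_pos in \<open>auto simp: u_def less_imp_le\<close>)
  with le show ?thesis
    unfolding x_def by (rule mult_right_le_imp_le)
qed

lemma singular_values_bidiagonal_mat:
  assumes "\<sigma> \<in> singular_values (bidiagonal_mat n \<omega>)"
  shows "sqrt (1 + (cmod \<omega>)\<^sup>2 - 2 * cmod \<omega> * cos (pi / (real n + 1))) \<le> \<sigma>"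
    and "\<sigma> \<le> sqrt (1 + (cmod \<omega>)\<^sup>2 + 2 * cmod \<omega> * cos (pi / (real n + 1)))"
proof -
  from assms obtain l where l: "\<sigma> = sqrt (Re l)"
      "l \<in> spectrum (bidiagonal_mat n \<omega> * mat_adjoint (bidiagonal_mat n \<omega>))"
    by (auto simp: singular_values_def)
  \<comment> \<open>The disc is projected to the real axis; \<open>sqrt\<close> is monotone on all
    reals, so the resulting bounds pass to the root.\<close>
  have "\<bar>Re (l - complex_of_real (1 + (cmod \<omega>)\<^sup>2))\<bar> \<le> 2 * cmod \<omega> * cos (pi / (real n + 1))"
    using abs_Re_le_cmod bidiagonal_mat_gram_spectrum_bound[OF l(2)] by (rule order_trans)
  then show "sqrt (1 + (cmod \<omega>)\<^sup>2 - 2 * cmod \<omega> * cos (pi / (real n + 1))) \<le> \<sigma>"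
    and "\<sigma> \<le> sqrt (1 + (cmod \<omega>)\<^sup>2 + 2 * cmod \<omega> * cos (pi / (real n + 1)))"
    by (auto simp: l(1) abs_le_iff)
qed

text \<open>This makes \<open>Max\<close> and \<open>Min\<close> meaningful: a complex square matrix
  of positive size has an eigenvalue, and only finitely many.\<close>

lemma finite_nonempty_singular_values:
  assumes "dim_row A \<noteq> 0"
  shows "finite (singular_values A)" "singular_values A \<noteq> {}"
proof -
  have "A * mat_adjoint A \<in> carrier_mat (dim_row A) (dim_row A)"
    by (intro carrier_matI) (auto simp: mat_adjoint_def)
  then show "finite (singular_values A)" "singular_values A \<noteq> {}"
    using assms spectrum_non_empty[of "A * mat_adjoint A" "dim_row A"]
      card_finite_spectrum(1)[of "A * mat_adjoint A" "dim_row A"]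
    by (simp_all add: singular_values_def)
qed

text \<open>The derivative of \<open>tan y - y\<close> is
  \<open>inverse ((cos y)\<^sup>2) - 1\<close>, which is nonnegative on the interval.\<close>

lemma le_tan:
  fixes x :: real
  assumes "0 \<le> x" "x < pi / 2"
  shows "x \<le> tan x"
proof -
  have "tan 0 - 0 \<le> tan x - x"
  proof (rule DERIV_nonneg_imp_nondecreasing[OF assms(1)])
    fix y :: real
    assume y: "0 \<le> y" "y \<le> x"
    then have "0 < cos y"
      using assms by (intro cos_gt_zero_pi) auto
    then have "((\<lambda>y. tan y - y) has_real_derivative inverse ((cos y)\<^sup>2) - 1) (at y)"
      by (auto intro!: derivative_eq_intros)
    moreover have "1 \<le> inverse ((cos y)\<^sup>2)"
      using \<open>0 < cos y\<close> by (intro one_le_inverse) (auto simp: power_le_one)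
    ultimately show "\<exists>d. ((\<lambda>y. tan y - y) has_real_derivative d) (at y) \<and> 0 \<le> d"
      by (intro exI conjI) auto
  qed
  then show ?thesis
    by simp
qed

theorem proposition3p2:
  fixes n :: nat and \<omega> :: complex
  assumes "n \<ge> 1"
  shows "1 \<le> condition_number (bidiagonal_mat n \<omega>) \<and>
    (cmod \<omega> \<in> {0<..<1} \<union> {1<..} \<longrightarrow>
       condition_number (bidiagonal_mat n \<omega>) \<le> \<bar>(cmod \<omega> + 1) / (cmod \<omega> - 1)\<bar>) \<and>
    (cmod \<omega> = 1 \<longrightarrow>
       condition_number (bidiagonal_mat n \<omega>) \<le> 2 / pi * (real n + 1)) \<and>
    (cmod \<omega> \<in> {0<..<1} \<union> {1<..} \<longrightarrow>
       sigma_max (bidiagonal_mat n \<omega>) \<le> \<bar>cmod \<omega> + 1\<bar> \<and>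
       sigma_min (bidiagonal_mat n \<omega>) \<ge> \<bar>cmod \<omega> - 1\<bar>)"
proof -
  define r where "r = cmod \<omega>"
  \<comment> \<open>Half the angle in \<open>c\<close>, so that the half-angle formulas turn
    \<open>1 - c\<close> and \<open>1 + c\<close> into squares.\<close>
  define x where "x = pi / (2 * (real n + 1))"
  define c where "c = cos (pi / (real n + 1))"
  let ?M = "bidiagonal_mat n \<omega>"
  have r: "0 \<le> r"
    by (simp add: r_def)
  have x: "0 < x" "x < pi / 2" "pi / (real n + 1) = 2 * x"
    using assms by (auto simp: x_def field_simps)
  have sin_cos_pos: "0 < sin x" "0 < cos x"
    using x by (auto intro!: sin_gt_zero2 cos_gt_zero)
  have c_sin: "1 - c = 2 * (sin x)\<^sup>2" and c_cos: "1 + c = 2 * (cos x)\<^sup>2"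
    unfolding c_def x(3) by (simp_all only: cos_double_sin, simp_all add: cos_squared_eq)
  have c: "c < 1"
    using c_sin sin_cos_pos by (smt (verit) zero_less_power)
  have fin: "finite (singular_values ?M)" "singular_values ?M \<noteq> {}"
    using assms by (auto intro!: finite_nonempty_singular_values simp: bidiagonal_mat_def)
  have lower: "sqrt (1 + r\<^sup>2 - 2 * r * c) \<le> sigma_min ?M"
    and upper: "sigma_max ?M \<le> sqrt (1 + r\<^sup>2 + 2 * r * c)"
    using singular_values_bidiagonal_mat[of _ n \<omega>] fin
    by (auto simp: sigma_min_def sigma_max_def r_def c_def)
  have min_le_max: "sigma_min ?M \<le> sigma_max ?M"
    using fin by (simp add: sigma_min_def sigma_max_def)
  \<comment> \<open>The radicand equals \<open>(1 - r)\<^sup>2 + 2 * r * (1 - c)\<close>. The second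
    term is positive even at \<open>r = 1\<close>, but vanishes at \<open>r = 0\<close>, where the
    radicand is 1. Thus the condition number is a genuine quotient.\<close>
  have "0 < 1 + r\<^sup>2 - 2 * r * c"
  proof (cases "r = 0")
    case False
    then have "0 < (1 - r)\<^sup>2 + 2 * r * (1 - c)"
      using r c by (intro add_nonneg_pos) auto
    then show ?thesis
      by (simp add: power2_eq_square algebra_simps)
  qed simp
  then have pos: "0 < sigma_min ?M"
    using lower by (meson less_le_trans real_sqrt_gt_zero)
  \<comment> \<open>Replacing \<open>c\<close> by 1 completes the squares
    \<open>(r - 1)\<^sup>2\<close> and \<open>(r + 1)\<^sup>2\<close>.\<close>
  have "2 * r * c \<le> 2 * r"
    using mult_left_mono[of c 1 "2 * r"] r c by simp
  then have "sqrt ((r - 1)\<^sup>2) \<le> sqrt (1 + r\<^sup>2 - 2 * r * c)"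
    and "sqrt (1 + r\<^sup>2 + 2 * r * c) \<le> sqrt ((r + 1)\<^sup>2)"
    by (auto simp: power2_eq_square algebra_simps simp del: real_sqrt_abs)
  then have bounds: "\<bar>r - 1\<bar> \<le> sigma_min ?M" "sigma_max ?M \<le> \<bar>r + 1\<bar>"
    using lower upper by auto
  have "1 \<le> condition_number ?M"
    using pos min_le_max by (simp add: condition_number_def)
  moreover have "condition_number ?M \<le> \<bar>(r + 1) / (r - 1)\<bar>" if "r \<noteq> 1"
    unfolding condition_number_def abs_divide
    using that bounds pos min_le_max by (intro frac_le) auto
  moreover have "condition_number ?M \<le> 2 / pi * (real n + 1)" if "r = 1"
  proof -
    \<comment> \<open>At \<open>r = 1\<close> the radicands are \<open>2 * (1 - c)\<close> and
      \<open>2 * (1 + c)\<close>.\<close>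
    have "sqrt (1 + r\<^sup>2 - 2 * r * c) = sqrt ((2 * sin x)\<^sup>2)"
      "sqrt (1 + r\<^sup>2 + 2 * r * c) = sqrt ((2 * cos x)\<^sup>2)"
      using that c_sin c_cos by (simp_all add: power_mult_distrib del: real_sqrt_abs)
    then have "2 * sin x \<le> sigma_min ?M" "sigma_max ?M \<le> 2 * cos x"
      using lower upper sin_cos_pos by (simp_all only: real_sqrt_abs)
    then have "condition_number ?M \<le> (2 * cos x) / (2 * sin x)"
      unfolding condition_number_def using sin_cos_pos by (intro frac_le) auto
    also have "\<dots> = 1 / tan x"
      by (simp add: tan_def)
    also have "\<dots> \<le> 1 / x"
      using x le_tan[of x] by (intro divide_left_mono) auto
    also have "\<dots> = 2 / pi * (real n + 1)"
      by (simp add: x_def)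
    finally show ?thesis .
  qed
  ultimately show ?thesis
    using bounds by (auto simp: r_def)
qed

end
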